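(* Let $\lambda>0$, let $k=\begin{pmatrix}A&B\\C&D\end{pmatrix}\in S$, and let $A_k$ be a unitary operator on $\mathcal F_\lambda$ such that $\rho(k\cdot h)A_k=A_k\rho(h)$ for every $h\in H_n$. Then the integral kernel $b_k(z,w)$ of $A_k$ is $$b_k(z,w)=c_k\,\exp\left(\frac\lambda4\,z^tCA^{-1}z+\frac\lambda2\,(A^{-1}z)^t\bar w-\frac\lambda4\,\bar w^tA^{-1}B\bar w\right)\qquad(z,w\in\mathbb C^n),$$ where $c_k\in\mathbb C$ is a constant.
   Context: Let $n\ge1$. Elements of $\mathbb C^n$ are column vectors and $u^tz=\sum_ju_jz_j$ (no conjugation). Let $\omega((z,w),(z',w'))=\frac i2(z^tw'-z'^tw)$. The Heisenberg group is $H_n=\{((z,\bar z),c): z\in\mathbb C^n,c\in\mathbb R\}$ with product $((z,\bar z),c)\cdot((z',\bar z'),c')=((z+z',\bar z+\bar z'),c+c'+\frac12\omega((z,\bar z),(z',\bar z')))$. $S$ is the group of complex $2n\times2n$ matrices of the form $\begin{pmatrix}P&Q\\\bar Q&\bar P\end{pmatrix}$ ($P,Q$ of size $n\times n$) which satisfy $M^tJM=J$ with $J=\begin{pmatrix}0&I_n\\-I_n&0\end{pmatrix}$ (for such matrices $P$ is invertible). It acts on $H_n$ by automorphisms: $\begin{pmatrix}A&B\\C&D\end{pmatrix}\cdot((z,\bar z),c)=((Az+B\bar z,Cz+D\bar z),c)$. $\mathcal F_\lambda$ is the Hilbert space of holomorphic $f$ on $\mathbb C^n$ with $\|f\|^2=\int|f(z)|^2e^{-\lambda|z|^2/2}\,d\mu_\lambda(z)<\infty$,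 $d\mu_\lambda(z)=(2\pi)^{-n}\lambda^n\,dm(z)$, $dm$ Lebesgue measure. The unitary irreducible representation $\rho=\rho_\lambda$ of $H_n$ on $\mathcal F_\lambda$ is $(\rho(h)f)(z)=\exp(i\lambda c_0+\frac\lambda2\bar z_0^tz-\frac\lambda4|z_0|^2)f(z-z_0)$ for $h=((z_0,\bar z_0),c_0)$. By the Stone–von Neumann theorem an operator $A_k$ as in the claim exists and is unique up to a unit complex number. With $e_z(w)=\exp(\lambda\bar z^tw/2)$, the integral kernel of a bounded operator $A$ on $\mathcal F_\lambda$ is $k_A(z,w)=\langle Ae_w,e_z\rangle_{\mathcal F_\lambda}$; it satisfies $(Af)(z)=\int k_A(z,w)f(w)e^{-\lambda|w|^2/2}\,d\mu_\lambda(w)$. *)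

theory Defs
  imports "HOL-Analysis.Analysis" "HOL-Algebra.Group"
begin

text \<open>The bilinear pairing \<open>u\<^sup>t z\<close>, without conjugation.\<close>
definition tdot :: "complex ^ 'n \<Rightarrow> complex ^ 'n \<Rightarrow> complex" where
  "tdot u z = (\<Sum>j\<in>UNIV. u $ j * z $ j)"

definition vcnj :: "complex ^ 'n \<Rightarrow> complex ^ 'n" where
  "vcnj z = (\<chi> i. cnj (z $ i))"

definition mcnj :: "complex ^ 'n ^ 'm \<Rightarrow> complex ^ 'n ^ 'm" where
  "mcnj M = (\<chi> i j. cnj (M $ i $ j))"

text \<open>Indices \<open>Inl i\<close> stand for the first \<open>n\<close> and \<open>Inr i\<close> for the last \<open>n\<close> coordinates.\<close>
definition block :: "'a ^ 'n::finite ^ 'n \<Rightarrow> 'a ^ 'n ^ 'n \<Rightarrow> 'a ^ 'n ^ 'n \<Rightarrow> 'a ^ 'n ^ 'n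
    \<Rightarrow> 'a ^ ('n + 'n) ^ ('n + 'n)" where
  "block A B C D = (\<chi> r s. case r of
      Inl i \<Rightarrow> (case s of Inl j \<Rightarrow> A $ i $ j | Inr j \<Rightarrow> B $ i $ j)
    | Inr i \<Rightarrow> (case s of Inl j \<Rightarrow> C $ i $ j | Inr j \<Rightarrow> D $ i $ j))"

definition symplJ :: "complex ^ ('n::finite + 'n) ^ ('n + 'n)" where
  "symplJ = block 0 (mat 1) (- mat 1) 0"

definition S_group :: "(complex ^ ('n::finite + 'n) ^ ('n + 'n)) monoid" where
  "S_group = \<lparr>carrier = {M. (\<exists>P Q. M = block P Q (mcnj Q) (mcnj P)) \<and>
                            transpose M ** symplJ ** M = symplJ},
              mult = (**), one = mat 1\<rparr>"

type_synonym 'n heis = "((complex ^ 'n) \<times> (complex ^ 'n)) \<times> real"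

definition omega :: "(complex ^ 'n) \<times> (complex ^ 'n) \<Rightarrow> (complex ^ 'n) \<times> (complex ^ 'n) \<Rightarrow> complex"
  where "omega = (\<lambda>(z, w) (z', w'). \<i> / 2 * (tdot z w' - tdot z' w))"

text \<open>On vectors \<open>(z, vcnj z)\<close> the form \<open>omega\<close> is real (lemma omega_real), so \<open>Re\<close> is only a coercion.\<close>
definition heisenberg :: "'n::finite heis monoid" where
  "heisenberg = \<lparr>carrier = {((z, vcnj z), c) | z c. True},
     mult = (\<lambda>(v, c) (v', c'). (v + v', c + c' + Re (omega v v') / 2)),
     one = ((0, 0), 0)\<rparr>"

lemma omega_real: "Im (omega (z, vcnj z) (z', vcnj z')) = 0"
proof -
  have "tdot z (vcnj z') = cnj (tdot z' (vcnj z))"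
    by (simp add: tdot_def vcnj_def mult.commute)
  then show ?thesis
    by (simp add: omega_def)
qed

definition heis_act :: "complex ^ ('n::finite + 'n) ^ ('n + 'n) \<Rightarrow> 'n::finite heis \<Rightarrow> 'n heis" where
  "heis_act M = (\<lambda>((z, w), c).
     (((\<chi> i j. M $ Inl i $ Inl j) *v z + (\<chi> i j. M $ Inl i $ Inr j) *v w,
       (\<chi> i j. M $ Inr i $ Inl j) *v z + (\<chi> i j. M $ Inr i $ Inr j) *v w), c))"

lemma heis_act_block:
  "heis_act (block A B C D) ((z, w), c) = ((A *v z + B *v w, C *v z + D *v w), c)"
  by (simp add: heis_act_def block_def)

text \<open>Complex differentiability: the real Frechet derivative exists and is complex linear.\<close>
definition holomorphic_Cn :: "(complex ^ 'n \<Rightarrow> complex) \<Rightarrow> bool" where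
  "holomorphic_Cn f \<longleftrightarrow> (\<forall>z. \<exists>a. (f has_derivative (\<lambda>h. tdot a h)) (at z))"

definition fock_measure :: "real \<Rightarrow> (complex ^ 'n) measure" where
  "fock_measure lam = density lborel (\<lambda>_. ennreal (lam ^ CARD('n) / (2 * pi) ^ CARD('n)))"

definition fock :: "real \<Rightarrow> (complex ^ 'n \<Rightarrow> complex) set" where
  "fock lam = {f. holomorphic_Cn f \<and>
     integrable (fock_measure lam) (\<lambda>z. (cmod (f z))\<^sup>2 * exp (- lam * (norm z)\<^sup>2 / 2))}"

text \<open>Linear in the first argument.\<close>
definition fock_inner ::
    "real \<Rightarrow> (complex ^ 'n \<Rightarrow> complex) \<Rightarrow> (complex ^ 'n \<Rightarrow> complex) \<Rightarrow> complex" where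
  "fock_inner lam f g =
     (LINT z|fock_measure lam. f z * cnj (g z) * of_real (exp (- lam * (norm z)\<^sup>2 / 2)))"

text \<open>Operators are total functions, of which only the values on \<open>fock lam\<close> matter.\<close>
definition fock_unitary ::
    "real \<Rightarrow> ((complex ^ 'n \<Rightarrow> complex) \<Rightarrow> (complex ^ 'n \<Rightarrow> complex)) \<Rightarrow> bool" where
  "fock_unitary lam T \<longleftrightarrow>
     (\<forall>f\<in>fock lam. \<forall>g\<in>fock lam. \<forall>a b.
        T (\<lambda>z. a * f z + b * g z) = (\<lambda>z. a * T f z + b * T g z)) \<and>
     bij_betw T (fock lam) (fock lam) \<and>
     (\<forall>f\<in>fock lam. \<forall>g\<in>fock lam. fock_inner lam (T f) (T g) = fock_inner lam f g)"

definition rho ::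
    "real \<Rightarrow> 'n::finite heis \<Rightarrow> (complex ^ 'n \<Rightarrow> complex) \<Rightarrow> complex ^ 'n \<Rightarrow> complex" where
  "rho lam = (\<lambda>((z0, w0), c0) f z.
     exp (\<i> * of_real lam * of_real c0 + of_real lam / 2 * tdot (vcnj z0) z
          - of_real (lam / 4 * (norm z0)\<^sup>2)) * f (z - z0))"

definition coherent :: "real \<Rightarrow> complex ^ 'n \<Rightarrow> complex ^ 'n \<Rightarrow> complex" where
  "coherent lam z w = exp (of_real lam * tdot (vcnj z) w / 2)"

definition fock_kernel ::
    "real \<Rightarrow> ((complex ^ 'n \<Rightarrow> complex) \<Rightarrow> (complex ^ 'n \<Rightarrow> complex))
     \<Rightarrow> complex ^ 'n \<Rightarrow> complex ^ 'n \<Rightarrow> complex" where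
  "fock_kernel lam T z w = fock_inner lam (T (coherent lam w)) (coherent lam z)"

end

theory Submission
  imports Defs "HOL-Probability.Distributions"
begin

text \<open>
  Writing \<open>P w = A w + B w\<^sup>*\<close> (with \<open>*\<close> for conjugation), the intertwining relation applied to
  coherent states gives \<open>b\<^sub>k(z, w) = H(z - P w) exp \<Psi>(z, w)\<close>, where \<open>\<Psi>\<close> is the claimed exponent and
  \<open>H(x) = \<langle>A\<^sub>k e\<^sub>0, e\<^sub>x\<rangle> exp(- (\<lambda>/4) x\<^sup>t C A\<^sup>-\<^sup>1 x)\<close> is holomorphic. Since \<open>A\<^sub>k\<close> is unitary,
  \<open>b\<^sub>k(z, w) = \<langle>e\<^sub>w, A\<^sub>k\<^sup>-\<^sup>1 e\<^sub>z\<rangle>\<close> is antiholomorphic in \<open>w\<close>, and so is \<open>\<Psi>\<close>. Hence the derivative of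
  \<open>H\<close> composed with \<open>P\<close> is antilinear; as its complex linear part is the derivative of \<open>H\<close> composed
  with the invertible matrix \<open>A\<close>, the function \<open>H\<close> is constant. No reproducing property is needed:
  holomorphy of \<open>x \<mapsto> \<langle>F, e\<^sub>x\<rangle>\<close> for \<open>F\<close> in the Fock space is a direct estimate under the integral.
\<close>

subsection \<open>The pairing and complex conjugation\<close>

lemma tdot_add_left: "tdot (x + y) z = tdot x z + tdot y z"
  and tdot_add_right: "tdot z (x + y) = tdot z x + tdot z y"
  and tdot_diff_left: "tdot (x - y) z = tdot x z - tdot y z"
  and tdot_diff_right: "tdot z (x - y) = tdot z x - tdot z y"
  by (simp_all add: tdot_def algebra_simps sum.distrib sum_subtractf)

lemma tdot_zero [simp]: "tdot 0 z = 0" "tdot z 0 = 0"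
  by (simp_all add: tdot_def)

lemma tdot_minus [simp]: "tdot (- x) y = - tdot x y" "tdot x (- y) = - tdot x y"
  by (simp_all add: tdot_def sum_negf)

lemma tdot_scaleR_left: "tdot (c *\<^sub>R x) y = of_real c * tdot x y"
  by (simp add: tdot_def scaleR_conv_of_real[where 'a = complex] sum_distrib_left mult.assoc)

lemma tdot_scaleR_right: "tdot x (c *\<^sub>R y) = of_real c * tdot x y"
  by (simp add: tdot_def scaleR_conv_of_real[where 'a = complex] sum_distrib_left mult_ac)

lemma tdot_scale_left: "tdot (c *s x) y = c * tdot x y"
  and tdot_scale_right: "tdot x (c *s y) = c * tdot x y"
  by (simp_all add: tdot_def sum_distrib_left mult_ac)

lemma tdot_commute: "tdot x y = tdot y x"
  by (simp add: tdot_def mult.commute)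

lemma norm_tdot_le: "cmod (tdot x y) \<le> norm x * norm y"
proof -
  have "cmod (tdot x y) \<le> (\<Sum>j\<in>UNIV. \<bar>cmod (x $ j)\<bar> * \<bar>cmod (y $ j)\<bar>)"
    unfolding tdot_def by (rule order_trans[OF norm_sum]) (simp add: norm_mult)
  also have "\<dots> \<le> norm x * norm y"
    unfolding norm_vec_def by (rule L2_set_mult_ineq)
  finally show ?thesis .
qed

lemma bounded_bilinear_tdot: "bounded_bilinear tdot"
  by unfold_locales
    (auto simp: tdot_add_left tdot_add_right tdot_scaleR_left tdot_scaleR_right scaleR_conv_of_real[where 'a = complex]
      intro: exI[of _ 1] simp: norm_tdot_le)

lemmas tdot_has_derivative [derivative_intros] =
  bounded_bilinear.FDERIV[OF bounded_bilinear_tdot]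
lemmas continuous_on_tdot [continuous_intros] =
  bounded_bilinear.continuous_on[OF bounded_bilinear_tdot]

lemma vcnj_add: "vcnj (x + y) = vcnj x + vcnj y"
  and vcnj_scale: "vcnj (c *s x) = cnj c *s vcnj x"
  and vcnj_scaleR: "vcnj (r *\<^sub>R x) = r *\<^sub>R vcnj x"
  and vcnj_matrix_mult: "vcnj (M *v x) = mcnj M *v vcnj x"
  by (simp_all add: vec_eq_iff vcnj_def mcnj_def matrix_vector_mult_def)

lemma vcnj_zero [simp]: "vcnj 0 = 0"
  and vcnj_vcnj [simp]: "vcnj (vcnj x) = x"
  and mcnj_mcnj [simp]: "mcnj (mcnj M) = M"
  by (simp_all add: vec_eq_iff vcnj_def mcnj_def)

lemma norm_vcnj [simp]: "norm (vcnj x) = norm x"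
  by (simp add: norm_vec_def vcnj_def)

lemma cnj_tdot: "cnj (tdot x y) = tdot (vcnj x) (vcnj y)"
  by (simp add: tdot_def vcnj_def)

text \<open>Turns squared norms into pairings, so that all exponents can be expanded bilinearly over
  the complex numbers.\<close>

lemma tdot_vcnj_self: "tdot (vcnj x) x = of_real ((norm x)\<^sup>2)"
proof -
  have "(norm x)\<^sup>2 = (\<Sum>j\<in>UNIV. (cmod (x $ j))\<^sup>2)"
    by (simp add: norm_vec_def L2_set_def sum_nonneg)
  then show ?thesis
    by (simp add: tdot_def vcnj_def complex_norm_square[symmetric] of_real_power mult.commute[of "cnj _"])
qed

lemma bounded_linear_vcnj: "bounded_linear vcnj"
  by (rule bounded_linear_intro[of _ 1]) (simp_all add: vcnj_add vcnj_scaleR)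

lemmas vcnj_has_derivative [derivative_intros] =
  bounded_linear.has_derivative[OF bounded_linear_vcnj]
lemmas continuous_on_vcnj [continuous_intros] =
  bounded_linear.continuous_on[OF bounded_linear_vcnj]

lemma bounded_linear_matrix_vector:
  "bounded_linear ((*v) (M :: complex ^ 'n ^ 'm))"
proof -
  have "linear ((*v) M)"
    by (rule linearI) (simp_all add: vec_eq_iff matrix_vector_mult_def
      scaleR_conv_of_real[where 'a = complex] sum_distrib_left sum.distrib algebra_simps)
  then show ?thesis by (rule linear_conv_bounded_linear[THEN iffD1])
qed

lemmas matrix_vector_has_derivative [derivative_intros] =
  bounded_linear.has_derivative[OF bounded_linear_matrix_vector]

lemma tdot_transpose: "tdot u (transpose M *v x) = tdot (M *v u) x"
  unfolding tdot_def matrix_vector_mult_def transpose_def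
  by (simp add: sum_distrib_left sum_distrib_right mult_ac) (rule sum.swap)

subsection \<open>Symplectic block matrices\<close>

text \<open>The column vector with two stacked blocks, on which a \<open>block\<close> matrix acts
  blockwise.\<close>

definition vjoin :: "'a ^ 'n \<Rightarrow> 'a ^ 'm \<Rightarrow> 'a ^ ('n + 'm)" where
  "vjoin x y = (\<chi> r. case r of Inl i \<Rightarrow> x $ i | Inr i \<Rightarrow> y $ i)"

lemma sum_UNIV_Plus:
  fixes f :: "'a::finite + 'b::finite \<Rightarrow> 'c::comm_monoid_add"
  shows "(\<Sum>r\<in>UNIV. f r) = (\<Sum>i\<in>UNIV. f (Inl i)) + (\<Sum>i\<in>UNIV. f (Inr i))"
  by (simp add: UNIV_Plus_UNIV[symmetric] sum.Plus del: UNIV_Plus_UNIV)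

lemma tdot_vjoin: "tdot (vjoin x y) (vjoin x' y') = tdot x x' + tdot y y'"
  by (simp add: tdot_def vjoin_def sum_UNIV_Plus)

lemma block_mult_vjoin:
  fixes A B C D :: "complex ^ 'n ^ 'n"
  shows "block A B C D *v vjoin x y = vjoin (A *v x + B *v y) (C *v x + D *v y)"
  by (simp add: vec_eq_iff matrix_vector_mult_def sum_UNIV_Plus block_def vjoin_def
      split: sum.split)

lemma block_inject:
  assumes "block A B C D = block A' B' C' D'"
  shows "A = A'" "B = B'" "C = C'" "D = D'"
proof -
  have *: "block A B C D $ r $ s = block A' B' C' D' $ r $ s" for r s
    using assms by simp
  show "A = A'" "B = B'" "C = C'" "D = D'"
    using *[of "Inl _" "Inl _"] *[of "Inl _" "Inr _"] *[of "Inr _" "Inl _"] *[of "Inr _" "Inr _"]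
    by (simp_all add: block_def vec_eq_iff)
qed

text \<open>The matrix identity says that the bilinear form given by \<open>symplJ\<close> is
  invariant under the block matrix; evaluating it on two stacked vectors gives the last claim. There
  \<open>x\<close> and \<open>y\<close> are independent rather than conjugate, so setting some of
  the vectors to zero recovers the blockwise identities such as \<open>A\<close>^t \<open>C\<close>
  = \<open>C\<close>^t \<open>A\<close> and \<open>A\<close>^t \<open>D\<close> - \<open>C\<close>^t
  \<open>B\<close> = 1.\<close>

lemma S_group_relations:
  assumes "block A B C D \<in> carrier S_group"
  shows S_group_C: "C = mcnj B" and S_group_D: "D = mcnj A"
    and S_group_tdot: "tdot (A *v x + B *v y) (C *v x' + D *v y')
        - tdot (C *v x + D *v y) (A *v x' + B *v y') = tdot x y' - tdot y x'"
proof -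
  from assms obtain P Q where PQ: "block A B C D = block P Q (mcnj Q) (mcnj P)"
    and J: "transpose (block A B C D) ** symplJ ** block A B C D = symplJ"
    by (auto simp: S_group_def)
  from block_inject[OF PQ] show "C = mcnj B" "D = mcnj A"
    by simp_all
  let ?M = "block A B C D"
  have J_vjoin: "symplJ *v vjoin x y = vjoin y (- x)" for x y :: "complex ^ 'a"
  proof -
    have "(- mat 1) *v x = - x"
      by (simp add: vec_eq_iff matrix_vector_mult_def mat_def sum_negf if_distrib[of "\<lambda>u. u * _"]
          cong: if_cong)
    then show ?thesis
      unfolding symplJ_def block_mult_vjoin by simp
  qed
  have "tdot (vjoin x y) ((transpose ?M ** symplJ ** ?M) *v vjoin x' y')
      = tdot (?M *v vjoin x y) (symplJ *v (?M *v vjoin x' y'))"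
    by (simp add: matrix_vector_mul_assoc[symmetric] tdot_transpose
        del: transpose_matrix_vector)
  then show "tdot (A *v x + B *v y) (C *v x' + D *v y')
        - tdot (C *v x + D *v y) (A *v x' + B *v y') = tdot x y' - tdot y x'"
    by (simp add: J block_mult_vjoin J_vjoin tdot_vjoin del: minus_add_distrib)
qed

text \<open>Pairing the images of \<open>(x, 0)\<close> and \<open>(0, vcnj x)\<close> yields |Ax|^2
  - |Cx|^2 = |x|^2, so \<open>A\<close> has trivial kernel.\<close>

lemma S_group_invertible:
  assumes "block A B C D \<in> carrier S_group"
  shows "invertible A"
proof -
  have "x = 0" if "A *v x = 0" for x
  proof -
    have "tdot (A *v x) (D *v vcnj x) - tdot (C *v x) (B *v vcnj x) = tdot x (vcnj x)"
      using S_group_tdot[OF assms, of x 0 0 "vcnj x"] by simp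
    moreover have "B *v vcnj x = vcnj (C *v x)"
      by (simp add: S_group_C[OF assms] vcnj_matrix_mult)
    ultimately have "tdot (vcnj (C *v x)) (C *v x) + tdot (vcnj x) x = 0"
      by (simp add: that tdot_commute add_eq_0_iff)
    then have "of_real ((norm (C *v x))\<^sup>2 + (norm x)\<^sup>2) = (0::complex)"
      by (simp add: tdot_vcnj_self)
    then have "(norm (C *v x))\<^sup>2 + (norm x)\<^sup>2 = 0"
      by (simp only: of_real_eq_0_iff)
    then show ?thesis
      by (simp add: sum_power2_eq_zero_iff)
  qed
  then show ?thesis
    using invertible_left_inverse matrix_left_invertible_ker by blast
qed

subsection \<open>Integrability in the Fock space\<close>

text \<open>The Gaussian is a product over coordinates, so Tonelli reduces the claim to a rescaled
  normal density on the line.\<close>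

lemma integrable_gauss:
  fixes a :: real
  assumes "a > 0"
  shows "integrable lborel (\<lambda>x :: 'a::euclidean_space. exp (- a * (norm x)\<^sup>2))"
proof (rule integrableI_nonneg)
  have one: "integrable lborel (\<lambda>x::real. exp (- a * x\<^sup>2))"
  proof -
    \<comment> \<open>The standard deviation for which 1/(2 s^2) = \<open>a\<close>.\<close>
    define s where "s = sqrt (1 / (2 * a))"
    have s: "s > 0" "2 * s\<^sup>2 = 1 / a"
      using assms by (simp_all add: s_def)
    have "integrable lborel (\<lambda>x. sqrt (2 * pi * s\<^sup>2) * normal_density 0 s x)"
      using s by (intro integrable_mult_right integrable_normal_density)
    also have "(\<lambda>x. sqrt (2 * pi * s\<^sup>2) * normal_density 0 s x) = (\<lambda>x. exp (- a * x\<^sup>2))"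
      using s by (auto simp: normal_density_def fun_eq_iff)
    finally show ?thesis .
  qed
  have norm_sq: "(norm x)\<^sup>2 = (\<Sum>b\<in>Basis. (x \<bullet> b)\<^sup>2)" for x :: 'a
    using euclidean_inner[of x x] unfolding power2_norm_eq_inner by (simp add: power2_eq_square)
  have "(\<integral>\<^sup>+(x::'a). ennreal (exp (- a * (norm x)\<^sup>2)) \<partial>lborel)
      = (\<integral>\<^sup>+(x::'a). (\<Prod>b\<in>Basis. ennreal (exp (- a * (x \<bullet> b)\<^sup>2))) \<partial>lborel)"
    by (simp add: prod_ennreal exp_sum[symmetric] sum_distrib_left[symmetric] sum_negf
        norm_sq)
  also have "\<dots> = (\<Prod>b\<in>(Basis :: 'a set). \<integral>\<^sup>+x. ennreal (exp (- a * x\<^sup>2)) \<partial>lborel)"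
    by (rule nn_integral_lborel_prod) auto
  also have "\<dots> < \<infinity>"
    using nn_integral_eq_integral[OF one] by (simp add: power_less_top_ennreal)
  finally show "(\<integral>\<^sup>+(x::'a). ennreal (exp (- a * (norm x)\<^sup>2)) \<partial>lborel) < \<infinity>" .
qed auto

lemma holomorphic_Cn_measurable:
  assumes "holomorphic_Cn f"
  shows "f \<in> borel_measurable borel"
proof -
  have "continuous_on UNIV f"
    using assms has_derivative_continuous
    by (fastforce simp: holomorphic_Cn_def continuous_on_eq_continuous_at)
  then show ?thesis
    by (rule borel_measurable_continuous_onI)
qed

lemma borel_measurable_cnj [measurable]: "cnj \<in> borel_measurable borel"
  by (intro borel_measurable_continuous_onI continuous_intros)

lemma fock_measurable: "f \<in> fock lam \<Longrightarrow> f \<in> borel_measurable borel"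
  by (simp add: fock_def holomorphic_Cn_measurable)

lemma fock_inner_lborel:
  fixes f g :: "complex ^ 'n \<Rightarrow> complex"
  assumes "lam > 0" and [measurable]: "f \<in> borel_measurable borel" "g \<in> borel_measurable borel"
  shows "fock_inner lam f g = of_real (lam ^ CARD('n) / (2 * pi) ^ CARD('n)) *
    (LINT u|lborel. f u * cnj (g u) * of_real (exp (- lam * (norm u)\<^sup>2 / 2)))"
  unfolding fock_inner_def fock_measure_def using assms(1)
  by (subst integral_density) (auto simp: scaleR_conv_of_real)

lemma integrable_fock_measure_iff:
  fixes f :: "complex ^ 'n \<Rightarrow> real"
  assumes "lam > 0" and [measurable]: "f \<in> borel_measurable borel"
  shows "integrable (fock_measure lam) f \<longleftrightarrow> integrable lborel f"
proof -
  define c where "c = lam ^ CARD('n) / (2 * pi) ^ CARD('n)"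
  have "c > 0"
    using assms(1) by (simp add: c_def)
  then show ?thesis
    unfolding fock_measure_def c_def[symmetric] by (subst integrable_density) auto
qed

lemma fock_inner_cnj: "cnj (fock_inner lam f g) = fock_inner lam g f"
  unfolding fock_inner_def Bochner_Integration.integral_cnj[symmetric]
  by (rule Bochner_Integration.integral_cong) (simp_all add: mult_ac)

text \<open>Completing the square absorbs the linear exponent into half of the Gaussian decay, at
  the cost of a constant factor.\<close>

lemma integrable_exp_norm_gauss:
  fixes a R :: real
  assumes "a > 0"
  shows "integrable lborel (\<lambda>u :: 'a::euclidean_space. exp (R * norm u) * exp (- a * (norm u)\<^sup>2))"
proof (rule Bochner_Integration.integrable_bound)
  show "integrable lborel (\<lambda>u::'a. exp (R\<^sup>2 / (2 * a)) * exp (- (a / 2) * (norm u)\<^sup>2))"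
    using assms by (intro integrable_mult_right integrable_gauss) simp
  have "R * norm u - a * (norm u)\<^sup>2 \<le> R\<^sup>2 / (2 * a) - (a / 2) * (norm u)\<^sup>2" for u :: 'a
  proof -
    have "0 \<le> (a * norm u - R)\<^sup>2 / (2 * a)"
      using assms by simp
    also have "\<dots> = R\<^sup>2 / (2 * a) + (a / 2) * (norm u)\<^sup>2 - R * norm u"
      using assms by (simp add: field_simps power2_eq_square)
    finally show ?thesis by simp
  qed
  then show "AE u::'a in lborel. norm (exp (R * norm u) * exp (- a * (norm u)\<^sup>2))
      \<le> norm (exp (R\<^sup>2 / (2 * a)) * exp (- (a / 2) * (norm u)\<^sup>2))"
    by (simp add: exp_add[symmetric])
qed measurable

text \<open>The bound |f p| \<le> |f|^2 + |p|^2 separates the two factors: the first is integrable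
  against the weight by membership in the Fock space, the second by its exponential growth. It
  serves for the exponential kernel, its derivative and the Taylor majorant alike.\<close>

lemma fock_mult_integrable:
  fixes f p :: "complex ^ 'n \<Rightarrow> complex"
  assumes "lam > 0" "f \<in> fock lam" and [measurable]: "p \<in> borel_measurable borel"
    and p: "\<And>u. cmod (p u) \<le> K * exp (R * norm u)"
  shows "integrable lborel (\<lambda>u. f u * p u * of_real (exp (- lam * (norm u)\<^sup>2 / 2)))"
proof (rule Bochner_Integration.integrable_bound)
  note [measurable] = fock_measurable[OF assms(2)]
  let ?w = "\<lambda>u::complex ^ 'n. exp (- lam * (norm u)\<^sup>2 / 2)"
  let ?p = "\<lambda>u::complex ^ 'n. K\<^sup>2 * (exp (2 * R * norm u) * exp (- (lam / 2) * (norm u)\<^sup>2))"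
  have "integrable lborel (\<lambda>u. (cmod (f u))\<^sup>2 * ?w u)"
    using assms(1,2) by (subst integrable_fock_measure_iff[OF assms(1), symmetric])
      (simp_all add: fock_def)
  moreover have "integrable lborel ?p"
    using assms(1) by (intro integrable_mult_right integrable_exp_norm_gauss) simp
  ultimately show "integrable lborel (\<lambda>u. (cmod (f u))\<^sup>2 * ?w u + ?p u)"
    by simp
  have "cmod (f u) * cmod (p u) * ?w u \<le> (cmod (f u))\<^sup>2 * ?w u + ?p u" for u
  proof -
    have "2 * (cmod (f u) * cmod (p u)) \<le> (cmod (f u))\<^sup>2 + (cmod (p u))\<^sup>2"
      using sum_squares_bound[of "cmod (f u)" "cmod (p u)"] by (simp add: mult.assoc)
    moreover have "cmod (f u) * cmod (p u) \<ge> 0"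
      by simp
    moreover have "(cmod (p u))\<^sup>2 \<le> (K * exp (R * norm u))\<^sup>2"
      by (intro power_mono p) simp
    ultimately have "cmod (f u) * cmod (p u) \<le> (cmod (f u))\<^sup>2 + (K * exp (R * norm u))\<^sup>2"
      by linarith
    then have "cmod (f u) * cmod (p u) * ?w u
        \<le> ((cmod (f u))\<^sup>2 + (K * exp (R * norm u))\<^sup>2) * ?w u"
      by (intro mult_right_mono) simp_all
    also have "\<dots> = (cmod (f u))\<^sup>2 * ?w u + ?p u"
      by (simp add: power_mult_distrib exp_double[symmetric] algebra_simps)
    finally show ?thesis .
  qed
  then show "AE u in lborel. norm (f u * p u * of_real (?w u))
      \<le> norm ((cmod (f u))\<^sup>2 * ?w u + ?p u)"
    by (intro always_eventually allI) (simp add: norm_mult order_trans[OF _ abs_ge_self])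
  show "(\<lambda>u. f u * p u * of_real (?w u)) \<in> borel_measurable lborel"
    by measurable
qed

section \<open>Coherent states: growth, holomorphy and membership in the Fock space\<close>

lemma cnj_coherent: "cnj (coherent lam z u) = exp (of_real lam * tdot z (vcnj u) / 2)"
  by (simp add: coherent_def cnj_tdot exp_cnj)

lemma coherent_zero: "coherent lam 0 = (\<lambda>u. 1)"
  by (simp add: coherent_def fun_eq_iff)

lemma coherent_norm_le:
  assumes "lam > 0"
  shows "cmod (coherent lam z u) \<le> exp (lam / 2 * norm z * norm u)"
proof -
  have "cmod (coherent lam z u) \<le> exp (lam / 2 * cmod (tdot (vcnj z) u))"
    unfolding coherent_def using assms by (rule_tac order_trans[OF norm_exp]) (simp add: norm_mult)
  also have "\<dots> \<le> exp (lam / 2 * norm z * norm u)"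
    using norm_tdot_le[of "vcnj z" u] assms by (simp add: mult.assoc)
  finally show ?thesis .
qed

lemma has_derivative_exp_complex:
  fixes g :: "'a::real_normed_vector \<Rightarrow> complex"
  assumes "(g has_derivative g') (at x)"
  shows "((\<lambda>x. exp (g x)) has_derivative (\<lambda>h. exp (g x) * g' h)) (at x)"
  using has_derivative_compose[OF assms, of exp "(*) (exp (g x))"] DERIV_exp[of "g x"]
  by (simp add: has_field_derivative_def)

lemma holomorphic_coherent: "holomorphic_Cn (coherent lam z)"
proof -
  have "bounded_linear (\<lambda>w. of_real lam / 2 * tdot (vcnj z) w)"
    by (intro bounded_linear_const_mult bounded_bilinear.bounded_linear_right[OF bounded_bilinear_tdot])
  from has_derivative_exp_complex[OF bounded_linear_imp_has_derivative[OF this]]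
  have "(coherent lam z has_derivative
      (\<lambda>h. tdot ((coherent lam z u * of_real lam / 2) *s vcnj z) h)) (at u)" for u
    by (simp add: coherent_def[abs_def] tdot_scale_left mult.assoc)
  then show ?thesis
    unfolding holomorphic_Cn_def by blast
qed

lemma coherent_in_fock:
  fixes z :: "complex ^ 'n"
  assumes "lam > 0"
  shows "coherent lam z \<in> fock lam"
proof -
  note [measurable] = holomorphic_Cn_measurable[OF holomorphic_coherent, of lam z]
  let ?f = "\<lambda>u. (cmod (coherent lam z u))\<^sup>2 * exp (- lam * (norm u)\<^sup>2 / 2)"
  have "integrable lborel ?f"
  proof (rule Bochner_Integration.integrable_bound)
    show "integrable lborel (\<lambda>u::complex ^ 'n.
        exp (lam * norm z * norm u) * exp (- (lam / 2) * (norm u)\<^sup>2))"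
      using assms by (intro integrable_exp_norm_gauss) simp
    have "(cmod (coherent lam z u))\<^sup>2 \<le> (exp (lam / 2 * norm z * norm u))\<^sup>2" for u
      by (intro power_mono coherent_norm_le assms) simp
    then show "AE u in lborel. norm (?f u)
        \<le> norm (exp (lam * norm z * norm u) * exp (- (lam / 2) * (norm u)\<^sup>2))"
      by (intro always_eventually allI) (simp add: exp_double[symmetric])
  qed measurable
  then show ?thesis
    by (subst (asm) integrable_fock_measure_iff[OF assms, symmetric])
      (simp_all add: fock_def holomorphic_coherent)
qed

subsection \<open>Differentiability of coherent state transforms\<close>

text \<open>Dividing the remainder by \<open>norm h\<close> leaves at most
  \<open>K * norm h\<close>, which tends to 0. This reduces differentiation under the integral to an
  integrated second-order Taylor estimate; restricting to \<open>norm h \<le> 1\<close> allows a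
  majorant independent of \<open>h\<close>.\<close>

lemma has_derivative_quadratic_bound:
  fixes f :: "'a::real_normed_vector \<Rightarrow> 'b::real_normed_vector"
  assumes "bounded_linear D"
    and bound: "\<And>h. norm h \<le> 1 \<Longrightarrow> norm (f (x + h) - f x - D h) \<le> K * (norm h)\<^sup>2"
  shows "(f has_derivative D) (at x)"
  unfolding has_derivative_at
proof (rule conjI[OF assms(1) Lim_null_comparison[where g = "\<lambda>h. K * norm h"]])
  show "\<forall>\<^sub>F h in at 0. norm (norm (f (x + h) - f x - D h) / norm h) \<le> K * norm h"
    unfolding eventually_at
  proof (intro exI[of _ 1] conjI ballI impI)
    fix h :: 'a
    assume h: "h \<noteq> 0 \<and> dist h 0 < 1"
    then have "norm (f (x + h) - f x - D h) \<le> K * (norm h)\<^sup>2"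
      by (intro bound) simp
    then show "norm (norm (f (x + h) - f x - D h) / norm h) \<le> K * norm h"
      using h by (simp add: divide_le_eq power2_eq_square mult.assoc)
  qed simp
  show "(\<lambda>h. K * norm h) \<midarrow>0\<rightarrow> 0"
    by (rule tendsto_eq_intros refl | simp)+
qed

lemma norm_exp_minus_linear_le: "cmod (exp t - 1 - t) \<le> (cmod t)\<^sup>2 * exp (cmod t)"
  using Taylor_exp_field[of t 1] by (simp add: diff_diff_eq power2_eq_square mult.commute)

text \<open>Conjugating the coherent state moves the bar from the parameter \<open>z\<close> to the
  integration variable, so \<open>z\<close> enters holomorphically.\<close>

lemma fock_inner_coherent:
  fixes F :: "complex ^ 'n \<Rightarrow> complex"
  assumes "lam > 0" "F \<in> fock lam"
  shows "fock_inner lam F (coherent lam z) = of_real (lam ^ CARD('n) / (2 * pi) ^ CARD('n)) *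
    (LINT u|lborel. F u * exp (of_real lam * tdot z (vcnj u) / 2)
      * of_real (exp (- lam * (norm u)\<^sup>2 / 2)))"
  unfolding cnj_coherent[symmetric]
  by (intro fock_inner_lborel assms(1) fock_measurable[OF assms(2)]
      holomorphic_Cn_measurable holomorphic_coherent)

text \<open>Differentiation under the integral: the exponent \<open>t\<close> is complex linear in
  its first argument, the first-order term of exp(\<open>t h u\<close>) gives the derivative, and
  the remainder is \<open>(norm h)\<^sup>2\<close> times a fixed integrable function.\<close>

lemma fock_inner_coherent_has_derivative:
  fixes F :: "complex ^ 'n \<Rightarrow> complex"
  assumes lam: "lam > 0" and F: "F \<in> fock lam"
  shows "\<exists>a. ((\<lambda>z. fock_inner lam F (coherent lam z)) has_derivative tdot a) (at z)"
proof -
  define c where "c = lam ^ CARD('n) / (2 * pi) ^ CARD('n)"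
  define W where "W u = complex_of_real (exp (- lam * (norm u)\<^sup>2 / 2))" for u :: "complex ^ 'n"
  define t where "t h u = of_real lam * tdot h (vcnj u) / 2" for h u :: "complex ^ 'n"
  have inner: "fock_inner lam F (coherent lam x) = of_real c * (LINT u|lborel. F u * exp (t x u) * W u)" for x
    unfolding c_def t_def W_def by (rule fock_inner_coherent[OF lam F])
  have t_add: "t (x + h) u = t x u + t h u" for x h u
    by (simp add: t_def tdot_add_left algebra_simps add_divide_distrib)
  have t_meas [measurable]: "t h \<in> borel_measurable borel" for h
    unfolding t_def[abs_def]
    by (intro borel_measurable_continuous_onI continuous_intros) simp
  have t_le: "cmod (t h u) \<le> lam / 2 * norm h * norm u" for h u
    using norm_tdot_le[of h "vcnj u"] lam by (simp add: t_def norm_mult mult.assoc)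
  have exp_t_le: "cmod (exp (t h u)) \<le> exp (lam / 2 * norm h * norm u)" for h u
    using norm_exp[of "t h u"] t_le[of h u] by (meson exp_le_cancel_iff order_trans)
  \<comment> \<open>Polynomial factors in \<open>norm u\<close> are majorised by exponentials, to
    fit the growth condition of \<open>int_mult\<close>.\<close>
  have norm_le_exp: "norm u \<le> exp (norm u)" for u :: "complex ^ 'n"
    using exp_ge_add_one_self[of "norm u"] by linarith
  have int_mult: "integrable lborel (\<lambda>u. F u * p u * W u)"
    if "p \<in> borel_measurable borel" "\<And>u. cmod (p u) \<le> K * exp (R * norm u)" for p K R
    unfolding W_def by (rule fock_mult_integrable[OF lam F that])
  have int_exp: "integrable lborel (\<lambda>u. F u * exp (t x u) * W u)" for x
    by (rule int_mult[where K = 1 and R = "lam / 2 * norm x"]) (simp_all only: exp_t_le mult_1, measurable)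
  have int_lin: "integrable lborel (\<lambda>u. F u * (exp (t z u) * t h u) * W u)" for h
  proof (rule int_mult)
    fix u
    have "cmod (exp (t z u) * t h u)
        \<le> exp (lam / 2 * norm z * norm u) * (lam / 2 * norm h * exp (norm u))"
      unfolding norm_mult using lam norm_le_exp[of u]
      by (intro mult_mono exp_t_le order_trans[OF t_le] mult_left_mono) simp_all
    also have "\<dots> = lam / 2 * norm h * exp ((lam / 2 * norm z + 1) * norm u)"
      by (simp add: exp_add[symmetric] algebra_simps)
    finally show "cmod (exp (t z u) * t h u)
        \<le> lam / 2 * norm h * exp ((lam / 2 * norm z + 1) * norm u)" .
  qed measurable
  \<comment> \<open>The components are the complex partial derivatives, computed under the integral
    sign.\<close>
  define a where "a = (\<chi> j. of_real c * (LINT u|lborel. F u * (exp (t z u) * t (axis j 1) u) * W u))"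
  have t_axis: "t h u = (\<Sum>j\<in>UNIV. t (axis j 1) u * h $ j)" for h u
  proof -
    have "tdot (axis j 1) x = x $ j" for j and x :: "complex ^ 'n"
      by (simp add: tdot_def axis_def if_distrib[of "\<lambda>u. u * _"] cong: if_cong)
    then show ?thesis
      by (simp add: t_def tdot_def sum_distrib_left sum_divide_distrib mult_ac)
  qed
  have lin: "tdot a h = of_real c * (LINT u|lborel. F u * (exp (t z u) * t h u) * W u)" for h
  proof -
    have "(LINT u|lborel. F u * (exp (t z u) * t h u) * W u)
        = (LINT u|lborel. (\<Sum>j\<in>UNIV. F u * (exp (t z u) * t (axis j 1) u) * W u * h $ j))"
      by (subst t_axis) (simp add: sum_distrib_left sum_distrib_right mult_ac)
    also have "\<dots> = (\<Sum>j\<in>UNIV. (LINT u|lborel. F u * (exp (t z u) * t (axis j 1) u) * W u) * h $ j)"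
      by (simp add: int_lin)
    finally show ?thesis
      by (simp add: tdot_def a_def sum_distrib_left mult_ac)
  qed
  \<comment> \<open>Majorant for the Taylor remainder: \<open>lam / 2\<close> comes from exp
    |\<open>t h u\<close>| with \<open>norm h \<le> 1\<close>, and 2 from bounding |u|^2 by
    exp(|u|)^2.\<close>
  define M where "M u = exp (t z u) * of_real (exp ((lam / 2 + 2) * norm u))" for u :: "complex ^ 'n"
  have int_M: "integrable lborel (\<lambda>u. F u * M u * W u)"
  proof (rule int_mult)
    fix u
    have "cmod (M u) \<le> exp (lam / 2 * norm z * norm u) * exp ((lam / 2 + 2) * norm u)"
      unfolding M_def norm_mult by (intro mult_mono exp_t_le) simp_all
    then show "cmod (M u) \<le> 1 * exp ((lam / 2 * norm z + lam / 2 + 2) * norm u)"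
      by (simp add: exp_add[symmetric] algebra_simps)
  qed (simp add: M_def[abs_def])
  \<comment> \<open>The factor \<open>(lam / 2)\<^sup>2\<close> is what |\<open>t h u\<close>|^2
    contributes beside \<open>(norm h)\<^sup>2\<close>.\<close>
  define K where "K = c * (lam / 2)\<^sup>2 * (LINT u|lborel. cmod (F u * M u * W u))"
  have "c \<ge> 0"
    using lam by (simp add: c_def)
  have bound: "cmod (fock_inner lam F (coherent lam (z + h)) - fock_inner lam F (coherent lam z)
      - tdot a h) \<le> K * (norm h)\<^sup>2" if h: "norm h \<le> 1" for h
  proof -
    let ?I = "\<lambda>u. F u * exp (t (z + h) u) * W u - F u * exp (t z u) * W u
      - F u * (exp (t z u) * t h u) * W u"
    have "cmod (?I u) \<le> (lam / 2)\<^sup>2 * (norm h)\<^sup>2 * cmod (F u * M u * W u)" for u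
    proof -
      have "cmod (t h u) \<le> lam / 2 * norm u"
        using t_le[of h u] lam mult_left_mono[OF h, of "lam / 2 * norm u"]
        by (simp only: mult_ac) simp
      then have "exp (cmod (t h u)) \<le> exp (lam / 2 * norm u)"
        by simp
      moreover have "(cmod (t h u))\<^sup>2 \<le> (lam / 2 * norm h * exp (norm u))\<^sup>2"
        using lam norm_le_exp[of u]
        by (intro power_mono order_trans[OF t_le] mult_left_mono) simp_all
      ultimately have "(cmod (t h u))\<^sup>2 * exp (cmod (t h u))
          \<le> (lam / 2 * norm h * exp (norm u))\<^sup>2 * exp (lam / 2 * norm u)"
        by (intro mult_mono) simp_all
      also have "\<dots> = (lam / 2)\<^sup>2 * (norm h)\<^sup>2 * exp ((lam / 2 + 2) * norm u)"
      proof -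
        have "exp ((lam / 2 + 2) * norm u) = (exp (norm u))\<^sup>2 * exp (lam / 2 * norm u)"
          by (simp add: exp_double[symmetric] exp_add[symmetric] algebra_simps)
        then show ?thesis
          by (simp only: power_mult_distrib mult_ac)
      qed
      finally have E: "cmod (exp (t h u) - 1 - t h u)
          \<le> (lam / 2)\<^sup>2 * (norm h)\<^sup>2 * exp ((lam / 2 + 2) * norm u)"
        using norm_exp_minus_linear_le[of "t h u"] by linarith
      have "?I u = F u * exp (t z u) * W u * (exp (t h u) - 1 - t h u)"
        by (simp add: t_add exp_add algebra_simps)
      then have "cmod (?I u) = cmod (F u * exp (t z u) * W u) * cmod (exp (t h u) - 1 - t h u)"
        by (simp only: norm_mult)
      also have "\<dots> \<le> cmod (F u * exp (t z u) * W u)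
          * ((lam / 2)\<^sup>2 * (norm h)\<^sup>2 * exp ((lam / 2 + 2) * norm u))"
        by (intro mult_left_mono E) simp
      finally show ?thesis
        by (simp add: M_def norm_mult mult_ac)
    qed
    then have "cmod (LINT u|lborel. ?I u)
        \<le> (LINT u|lborel. (lam / 2)\<^sup>2 * (norm h)\<^sup>2 * cmod (F u * M u * W u))"
      by (intro Bochner_Integration.integral_norm_bound_integral Bochner_Integration.integrable_diff int_exp int_lin
          integrable_mult_right integrable_norm int_M)
    then have "c * cmod (LINT u|lborel. ?I u) \<le> K * (norm h)\<^sup>2"
      using mult_left_mono[OF _ \<open>c \<ge> 0\<close>] by (fastforce simp: K_def mult_ac)
    moreover have "fock_inner lam F (coherent lam (z + h)) - fock_inner lam F (coherent lam z)
        - tdot a h = of_real c * (LINT u|lborel. ?I u)"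
      by (simp add: inner lin int_exp int_lin Bochner_Integration.integral_diff
          Bochner_Integration.integrable_diff right_diff_distrib)
    ultimately show ?thesis
      using \<open>c \<ge> 0\<close> by (simp add: norm_mult)
  qed
  have "((\<lambda>z. fock_inner lam F (coherent lam z)) has_derivative tdot a) (at z)"
    by (rule has_derivative_quadratic_bound[OF
        bounded_bilinear.bounded_linear_right[OF bounded_bilinear_tdot] bound])
  then show ?thesis by blast
qed

subsection \<open>The kernel of the intertwining operator\<close>

lemma lborel_integral_translation:
  fixes f :: "'a::euclidean_space \<Rightarrow> 'b::{banach, second_countable_topology}"
  assumes [measurable]: "f \<in> borel_measurable borel"
  shows "(LINT u|lborel. f (p + u)) = (LINT u|lborel. f u)"
proof -
  have "(LINT u|lborel. f u) = (LINT u|distr lborel borel ((+) p). f u)"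
    by (simp add: lborel_distr_plus)
  also have "\<dots> = (LINT u|lborel. f (p + u))"
    by (rule integral_distr) auto
  finally show ?thesis ..
qed

text \<open>The adjoint of a Heisenberg translation sends a coherent state to a multiple of a
  coherent state. Shifting the integration variable by \<open>p\<close> shows it: of the cross terms
  of |p + u|^2, one cancels the exponent of \<open>rho\<close> and the other turns \<open>z\<close>
  into \<open>z - p\<close>.\<close>

lemma fock_inner_rho_coherent:
  fixes g :: "complex ^ 'n \<Rightarrow> complex"
  assumes lam: "lam > 0" and g: "g \<in> fock lam"
  shows "fock_inner lam (rho lam ((p, vcnj p), 0) g) (coherent lam z) =
    exp (of_real lam / 2 * tdot z (vcnj p) - of_real (lam / 4 * (norm p)\<^sup>2))
      * fock_inner lam g (coherent lam (z - p))"
proof -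
  note [measurable] = fock_measurable[OF g]
    holomorphic_Cn_measurable[OF holomorphic_coherent, of lam z]
  define c where "c = complex_of_real (lam ^ CARD('n) / (2 * pi) ^ CARD('n))"
  define f where "f u = rho lam ((p, vcnj p), 0) g u * cnj (coherent lam z u)
      * of_real (exp (- lam * (norm u)\<^sup>2 / 2))" for u
  have [measurable]: "rho lam ((p, vcnj p), 0) g \<in> borel_measurable borel"
  proof -
    have [measurable]: "tdot (vcnj p) \<in> borel_measurable borel"
      by (intro borel_measurable_continuous_onI continuous_intros)
    show ?thesis
      unfolding rho_def by simp
  qed
  have [measurable]: "f \<in> borel_measurable borel"
    unfolding f_def[abs_def] by measurable
  have f_shift: "f (p + u)
      = exp (of_real lam / 2 * tdot z (vcnj p) - of_real (lam / 4 * (norm p)\<^sup>2))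
        * (g u * exp (of_real lam * tdot (z - p) (vcnj u) / 2)
          * of_real (exp (- lam * (norm u)\<^sup>2 / 2)))" for u
  proof -
    let ?x = "of_real lam / 2 * tdot (vcnj p) (p + u) - of_real (lam / 4 * (norm p)\<^sup>2)
      + of_real lam * tdot z (vcnj (p + u)) / 2
      + of_real (- lam * (norm (p + u))\<^sup>2 / 2)"
    have norm_add: "complex_of_real ((norm (p + u))\<^sup>2)
        = of_real ((norm p)\<^sup>2) + tdot (vcnj p) u + tdot p (vcnj u) + of_real ((norm u)\<^sup>2)"
      unfolding tdot_vcnj_self[symmetric]
      by (simp add: vcnj_add tdot_add_left tdot_add_right tdot_commute[of "vcnj u"])
    have "f (p + u) = g u * exp ?x"
      by (simp only: f_def rho_def cnj_coherent exp_of_real exp_add split_conv) simp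
    also have "?x = of_real lam / 2 * tdot z (vcnj p) - of_real (lam / 4 * (norm p)\<^sup>2)
        + of_real lam * tdot (z - p) (vcnj u) / 2 + of_real (- lam * (norm u)\<^sup>2 / 2)"
      using norm_add tdot_vcnj_self[of p]
      by (simp add: vcnj_add tdot_add_right tdot_diff_left field_simps)
    finally show ?thesis
      by (simp only: exp_add exp_of_real mult_ac)
  qed
  have "fock_inner lam (rho lam ((p, vcnj p), 0) g) (coherent lam z) = c * (LINT u|lborel. f u)"
    unfolding c_def f_def by (rule fock_inner_lborel[OF lam]) measurable
  also have "(LINT u|lborel. f u) = (LINT u|lborel. f (p + u))"
    by (simp add: lborel_integral_translation)
  also have "\<dots> = exp (of_real lam / 2 * tdot z (vcnj p) - of_real (lam / 4 * (norm p)\<^sup>2))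
      * (LINT u|lborel. g u * exp (of_real lam * tdot (z - p) (vcnj u) / 2)
          * of_real (exp (- lam * (norm u)\<^sup>2 / 2)))"
    unfolding f_shift by (rule integral_mult_right_zero)
  finally show ?thesis
    unfolding fock_inner_coherent[OF lam g] c_def by (simp only: mult_ac)
qed

lemma fock_inner_scale: "fock_inner lam (\<lambda>u. s * f u) g = s * fock_inner lam f g"
  by (simp add: fock_inner_def mult.assoc)

theorem proposition4p1:
  fixes lam :: real
    and A B C D :: "complex ^ 'n ^ 'n"
    and k :: "complex ^ ('n::finite + 'n) ^ ('n + 'n)"
    and Ak :: "(complex ^ 'n \<Rightarrow> complex) \<Rightarrow> (complex ^ 'n \<Rightarrow> complex)"
  assumes "lam > 0"
    and "k = block A B C D"
    and "k \<in> carrier S_group"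
    and "fock_unitary lam Ak"
    and "\<forall>h\<in>carrier heisenberg. \<forall>f\<in>fock lam.
           rho lam (heis_act k h) (Ak f) = Ak (rho lam h f)"
  shows "\<exists>c. \<forall>z w. fock_kernel lam Ak z w =
           c * exp (of_real lam / 4 * tdot z ((C ** matrix_inv A) *v z)
                    + of_real lam / 2 * tdot (matrix_inv A *v z) (vcnj w)
                    - of_real lam / 4 * tdot (vcnj w) ((matrix_inv A ** B) *v vcnj w))"
proof -
  note lam = assms(1)
  have S: "block A B C D \<in> carrier S_group"
    using assms(2,3) by simp
  define R where "R = matrix_inv A"
  have "invertible A"
    by (rule S_group_invertible[OF S])
  then have "A ** R = mat 1 \<and> R ** A = mat 1"
    unfolding invertible_def R_def matrix_inv_def by (rule someI_ex)
  then have A_R [simp]: "A *v (R *v x) = x" and R_A [simp]: "R *v (A *v x) = x" for x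
    by (simp_all add: matrix_vector_mul_assoc)

  \<comment> \<open>Algebra of the exponent\<close>
  define q where "q x y = tdot x (C *v (R *v y))" for x y
  define P where "P w = A *v w + B *v vcnj w" for w
  define Psi where "Psi z w = of_real lam / 4 * q z z + of_real lam / 2 * tdot (R *v z) (vcnj w)
    - of_real lam / 4 * tdot (vcnj w) (R *v (B *v vcnj w))" for z w

  \<comment> \<open>The matrix \<open>C ** R\<close> is symmetric, because \<open>A\<close>^t
    \<open>C\<close> is.\<close>
  have q_sym: "q x y = tdot (C *v (R *v x)) y" for x y
    using S_group_tdot[OF S, of "R *v x" 0 "R *v y" 0] by (simp add: q_def)
  have vcnj_P: "vcnj (P w) = C *v w + D *v vcnj w" for w
    by (simp add: P_def vcnj_add vcnj_matrix_mult S_group_C[OF S] S_group_D[OF S] add.commute)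
  \<comment> \<open>The terms in \<open>C *v w\<close> cancel; the rest is the symplectic relation
    between \<open>(R *v x, 0)\<close> and \<open>(0, vcnj w)\<close>. The result is antilinear in
    \<open>w\<close>.\<close>
  have pairing: "tdot x (vcnj (P w)) - q x (P w) = tdot (R *v x) (vcnj w)" for x w
  proof -
    have "q x (P w) = tdot x (C *v w) + q x (B *v vcnj w)"
      by (simp add: q_def P_def matrix_vector_right_distrib tdot_add_right)
    then show ?thesis
      using S_group_tdot[OF S, of "R *v x" 0 0 "vcnj w"] q_sym[of x "B *v vcnj w"]
      by (simp add: vcnj_P tdot_add_right)
  qed
  \<comment> \<open>The summands are the normalisation relating \<open>coherent lam w\<close> to a
    translate of \<open>coherent lam 0\<close>, the factor of \<open>fock_inner_rho_coherent\<close>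
    at \<open>P w\<close>, and the Gaussian that will be split off from \<open>G\<close>.\<close>
  have exponent: "of_real (lam / 4 * (norm w)\<^sup>2)
      + (of_real lam / 2 * tdot z (vcnj (P w)) - of_real (lam / 4 * (norm (P w))\<^sup>2))
      + of_real lam / 4 * q (z - P w) (z - P w) = Psi z w" for z w
  proof -
    have "q (z - P w) (z - P w) = q z z - q z (P w) - q (P w) z + q (P w) (P w)"
      by (simp add: q_def matrix_vector_mult_diff_distrib tdot_diff_left tdot_diff_right)
    moreover have "q (P w) z = q z (P w)"
      unfolding q_sym[of z "P w"] unfolding q_def by (rule tdot_commute)
    moreover have "q z (P w) = tdot z (vcnj (P w)) - tdot (R *v z) (vcnj w)"
      using pairing[of z w] by (simp add: algebra_simps)
    moreover have "R *v P w = w + R *v (B *v vcnj w)"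
      by (simp add: P_def matrix_vector_right_distrib)
    \<comment> \<open>Taking \<open>x = P w\<close> in \<open>pairing\<close> produces |w|^2, which
      cancels the normalisation of \<open>coherent lam w\<close>.\<close>
    then have "q (P w) (P w)
        = of_real ((norm (P w))\<^sup>2) - of_real ((norm w)\<^sup>2) - tdot (vcnj w) (R *v (B *v vcnj w))"
      using pairing[of "P w" w] tdot_vcnj_self[of "P w"] tdot_vcnj_self[of w]
      by (simp add: tdot_add_left tdot_add_right tdot_commute[of _ "vcnj _"] algebra_simps)
    ultimately have qq: "q (z - P w) (z - P w) = q z z - 2 * tdot z (vcnj (P w))
        + 2 * tdot (R *v z) (vcnj w) + of_real ((norm (P w))\<^sup>2) - of_real ((norm w)\<^sup>2)
        - tdot (vcnj w) (R *v (B *v vcnj w))"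
      by simp
    show ?thesis
      unfolding Psi_def qq by (simp add: field_simps)
  qed

  \<comment> \<open>Factorisation of the kernel by intertwining\<close>
  have Ak_linear: "Ak (\<lambda>u. s * f u) = (\<lambda>u. s * Ak f u)" if "f \<in> fock lam" for s f
  proof -
    have "Ak (\<lambda>z. s * f z + 0 * f z) = (\<lambda>z. s * Ak f z + 0 * Ak f z)"
      using assms(4) that unfolding fock_unitary_def by blast
    then show ?thesis by simp
  qed
  have Ak_bij: "bij_betw Ak (fock lam) (fock lam)"
    and Ak_inner: "\<And>f g. \<lbrakk>f \<in> fock lam; g \<in> fock lam\<rbrakk>
      \<Longrightarrow> fock_inner lam (Ak f) (Ak g) = fock_inner lam f g"
    using assms(4) by (simp_all add: fock_unitary_def)

  define g where "g = Ak (coherent lam 0)"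
  have g: "g \<in> fock lam"
    using Ak_bij coherent_in_fock[OF lam] by (auto simp: g_def bij_betw_def)
  define G where "G x = fock_inner lam g (coherent lam x)" for x
  \<comment> \<open>\<open>H\<close> is the quotient of \<open>G\<close> by the Gaussian expected
    from the claimed formula at \<open>w = 0\<close>; the theorem amounts to its constancy.\<close>
  define H where "H x = G x * exp (- of_real lam / 4 * q x x)" for x

  txt \<open>Up to a scalar, \<open>coherent lam w\<close> is the translate of \<open>coherent lam 0\<close> under \<open>rho\<close>, and
    the intertwining relation turns translation by \<open>w\<close> into translation by \<open>P w\<close>.\<close>
  have kernel_H: "fock_kernel lam Ak z w = H (z - P w) * exp (Psi z w)" for z w
  proof -
    let ?s = "complex_of_real (lam / 4 * (norm w)\<^sup>2)"
    let ?h = "((w, vcnj w), 0) :: 'n heis"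
    have "rho lam ?h (coherent lam 0) = (\<lambda>u. exp (- ?s) * coherent lam w u)"
      by (simp add: rho_def coherent_zero fun_eq_iff)
        (simp add: coherent_def exp_add[symmetric] exp_diff[symmetric])
    moreover have "heis_act k ?h = ((P w, vcnj (P w)), 0)"
      by (simp add: assms(2) heis_act_block P_def[symmetric] vcnj_P)
    moreover have "?h \<in> carrier heisenberg"
      by (auto simp: heisenberg_def)
    ultimately have "rho lam ((P w, vcnj (P w)), 0) g = (\<lambda>u. exp (- ?s) * Ak (coherent lam w) u)"
      using assms(5) coherent_in_fock[OF lam] by (metis Ak_linear g_def)
    then have "exp (- ?s) * fock_kernel lam Ak z w
        = fock_inner lam (rho lam ((P w, vcnj (P w)), 0) g) (coherent lam z)"
      by (simp add: fock_kernel_def fock_inner_scale)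
    then have "fock_kernel lam Ak z w = exp ?s *
        fock_inner lam (rho lam ((P w, vcnj (P w)), 0) g) (coherent lam z)"
      by (simp add: exp_minus field_simps)
    also have "\<dots> = exp (?s + (of_real lam / 2 * tdot z (vcnj (P w))
        - of_real (lam / 4 * (norm (P w))\<^sup>2))) * G (z - P w)"
      by (simp only: fock_inner_rho_coherent[OF lam g] G_def exp_add mult.assoc)
    also have "G (z - P w) = H (z - P w) * exp (of_real lam / 4 * q (z - P w) (z - P w))"
      by (simp add: H_def exp_add[symmetric])
    finally show ?thesis
      by (simp only: exponent[symmetric] exp_add mult_ac)
  qed

  \<comment> \<open>Holomorphy and constancy of the remaining factor\<close>
  have H_holo: "\<exists>a. (H has_derivative tdot a) (at x)" for x
  proof -
    obtain a where a: "(G has_derivative tdot a) (at x)"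
      using fock_inner_coherent_has_derivative[OF lam g, of x] unfolding G_def[abs_def] by blast
    let ?E = "exp (- of_real lam / 4 * q x x)"
    have "((\<lambda>x. q x x) has_derivative (\<lambda>h. tdot x (C *v (R *v h)) + tdot h (C *v (R *v x)))) (at x)"
      unfolding q_def by (intro derivative_intros)
    \<comment> \<open>Symmetry of \<open>q\<close> merges the two terms of the product rule.\<close>
    then have "((\<lambda>x. q x x) has_derivative (\<lambda>h. 2 * tdot (C *v (R *v x)) h)) (at x)"
      by (simp add: q_sym[unfolded q_def, of x] tdot_commute[of _ "C *v (R *v x)"])
    from has_derivative_mult[OF a has_derivative_exp_complex[OF has_derivative_mult_right[OF this]]]
    have "(H has_derivative (\<lambda>h. tdot (?E *s a - (G x * ?E * of_real lam / 2) *s (C *v (R *v x))) h)) (at x)"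
      unfolding H_def[abs_def]
      by (rule has_derivative_eq_rhs) (simp add: fun_eq_iff tdot_diff_left tdot_scale_left algebra_simps)
    then show ?thesis by blast
  qed

  \<comment> \<open>The kernel is differentiated in \<open>w\<close> at 0 only: since
    \<open>P 0 = 0\<close>, this probes \<open>H\<close> at the arbitrary point
    \<open>z\<close>.\<close>
  have "(H has_derivative (\<lambda>_. 0)) (at z)" for z
  proof -
    obtain a where a: "(H has_derivative tdot a) (at z)"
      using H_holo by blast
    have P0 [simp]: "P 0 = 0"
      by (simp add: P_def)
    have "((\<lambda>w. z - P w) has_derivative (\<lambda>h. - P h)) (at 0)"
      unfolding P_def by (auto intro!: derivative_eq_intros)
    from has_derivative_compose[OF this, of H "tdot a"] a
    have "((\<lambda>w. H (z - P w)) has_derivative (\<lambda>h. - tdot a (P h))) (at 0)"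
      by simp
    moreover have "(Psi z has_derivative (\<lambda>h. of_real lam / 2 * tdot (R *v z) (vcnj h))) (at 0)"
      unfolding Psi_def by (auto intro!: derivative_eq_intros)
    ultimately have 1: "((\<lambda>w. fock_kernel lam Ak z w) has_derivative
        (\<lambda>h. H z * (exp (Psi z 0) * (of_real lam / 2 * tdot (R *v z) (vcnj h)))
          - tdot a (P h) * exp (Psi z 0))) (at 0)"
      unfolding kernel_H
      by (auto intro!: derivative_eq_intros has_derivative_exp_complex)
    \<comment> \<open>With \<open>F\<close> the preimage of the coherent state, unitarity moves the
      operator off \<open>coherent lam w\<close>, and the kernel becomes the conjugate of a
      holomorphic function of \<open>w\<close>.\<close>
    obtain F where F: "F \<in> fock lam" "Ak F = coherent lam z"
      using Ak_bij coherent_in_fock[OF lam, of z] by (metis bij_betw_imp_surj_on imageE)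
    have "fock_kernel lam Ak z w = cnj (fock_inner lam F (coherent lam w))" for w
      using Ak_inner[OF coherent_in_fock[OF lam] F(1), of w]
      by (simp add: fock_kernel_def F(2) fock_inner_cnj)
    moreover obtain b
      where "((\<lambda>w. fock_inner lam F (coherent lam w)) has_derivative tdot b) (at 0)"
      using fock_inner_coherent_has_derivative[OF lam F(1)] by blast
    ultimately have 2: "((\<lambda>w. fock_kernel lam Ak z w) has_derivative
        (\<lambda>h. tdot (vcnj b) (vcnj h))) (at 0)"
      by (simp add: has_derivative_cnj flip: cnj_tdot)
    \<comment> \<open>Collects the terms antilinear in \<open>h\<close> when the two derivatives are
      equated.\<close>
    define d where "d = vcnj b - (H z * exp (Psi z 0) * of_real lam / 2) *s (R *v z)"
    have antilinear: "- tdot a (P h) * exp (Psi z 0) = tdot d (vcnj h)" for h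
      using fun_cong[OF has_derivative_unique[OF 1 2], of h]
      by (simp add: d_def tdot_diff_left tdot_scale_left algebra_simps)
    txt \<open>Replacing \<open>h\<close> by \<open>\<i> h\<close> isolates the complex linear part of \<open>tdot a \<circ> P\<close>.\<close>
    have "tdot a (A *v h) = 0" for h
    proof -
      have "P (\<i> *s h) = \<i> *s (A *v h - B *v vcnj h)"
        by (simp add: P_def vcnj_scale vec_eq_iff matrix_vector_mult_def sum_distrib_left
            sum_subtractf algebra_simps sum_negf)
      then have "tdot a (P (\<i> *s h)) = \<i> * tdot a (A *v h - B *v vcnj h)"
        by (simp only: tdot_scale_right)
      then have "tdot a (A *v h - B *v vcnj h) * exp (Psi z 0) = tdot d (vcnj h)"
        using antilinear[of "\<i> *s h"] by (simp add: vcnj_scale tdot_scale_right)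
      with antilinear[of h] have "2 * tdot a (A *v h) * exp (Psi z 0) = 0"
        by (simp add: P_def tdot_add_right tdot_diff_right algebra_simps)
      then show ?thesis by simp
    qed
    \<comment> \<open>Every vector lies in the range of \<open>A\<close>, as \<open>A_R\<close>
      shows.\<close>
    from this[of "R *v _"] have "tdot a = (\<lambda>_. 0)"
      by (simp add: fun_eq_iff)
    with a show ?thesis by simp
  qed
  then obtain c where "\<And>x. H x = c"
    using has_derivative_zero_constant[of UNIV H] by auto
  then show ?thesis
    by (intro exI[of _ c])
      (simp add: kernel_H Psi_def q_def R_def matrix_vector_mul_assoc)
qed

end
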